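(* Let $P' \subseteq \mathbb{R}^p$ be a $0/1$-polytope and $j \in \{1,\dots,p\}$ such that $\operatorname{down}_j$ is injective on the vertex set of $P'$. Then \[ \operatorname{xc}^*\big(\operatorname{conv}(P' \cup \operatorname{down}_j(P'))\big) \leq \operatorname{xc}^*(P') + 2. \]
   Context: $\operatorname{down}_j\colon\mathbb{R}^p\to\mathbb{R}^p$ is the map with $\operatorname{down}_j(x)_i = 0$ if $i = j$ and $\operatorname{down}_j(x)_i = x_i$ otherwise. A $0/1$-polytope is a polytope all of whose vertices lie in $\{0,1\}^p$. For a polytope $P \subseteq \mathbb{R}^p$, an extension of $P$ is a pair $(Q,\pi)$ with $Q \subseteq \mathbb{R}^q$ a polyhedron and $\pi\colon\mathbb{R}^q\to\mathbb{R}^p$ linear with $\pi(Q)=P$; its size is the number of facets of $Q$. An extension $(Q,\pi)$ of a $0/1$-polytope $P$ is a nice $0/1$-extension if (i) $Q$ is a $0/1$-polytope, (ii) each vertex of $Q$ is mapped by $\pi$ onto a vertex of $P$, and (iii) for each vertex $v$ of $P$ there is exactly one vertex of $Q$ mapped onto $v$. $\operatorname{xc}^*(P)$ is the smallest size of a nice $0/1$-extension of $P$. *)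

theory Defs
  imports "HOL-Analysis.Analysis" "HOL-Library.Function_Algebras"
begin

text \<open>The dimension of the ambient space of an extension is existentially quantified, so it
  cannot be the cardinality of an index type. We realise $\mathbb{R}^q$ as the subspace of
  \<^typ>\<open>nat \<Rightarrow> real\<close> of the sequences supported on the first $q$ indices. With the pointwise
  vector space structure, the library notions \<^const>\<open>polytope\<close>, \<^const>\<open>extreme_point_of\<close>,
  \<^const>\<open>face_of\<close> and \<^const>\<open>linear\<close> apply to its subsets.\<close>

instantiation "fun" :: (type, real_vector) real_vector
begin

definition scaleR_fun :: "real \<Rightarrow> ('a \<Rightarrow> 'b) \<Rightarrow> 'a \<Rightarrow> 'b" where
  "scaleR_fun c f = (\<lambda>x. c *\<^sub>R f x)"

instance
  by standard (simp_all add: scaleR_fun_def fun_eq_iff scaleR_add_right scaleR_add_left)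

end

definition coord_space :: "nat \<Rightarrow> (nat \<Rightarrow> real) set" where
  "coord_space q = {x. \<forall>i\<ge>q. x i = 0}"

definition vertices :: "'a::real_vector set \<Rightarrow> 'a set" where
  "vertices S = {v. v extreme_point_of S}"

text \<open>The library defines \<^const>\<open>aff_dim\<close> and \<^const>\<open>facet_of\<close> on Euclidean spaces only. The
  following versions make sense in any real vector space (for sets whose affine hull is finite
  dimensional) and agree with the library on Euclidean spaces.\<close>

definition affine_dim :: "'a::real_vector set \<Rightarrow> int" where
  "affine_dim S = (if S = {} then -1 else int (dim {x - y | x y. x \<in> S \<and> y \<in> S}))"

definition is_facet_of :: "'a::real_vector set \<Rightarrow> 'a set \<Rightarrow> bool" where
  "is_facet_of F S \<longleftrightarrow> F face_of S \<and> F \<noteq> {} \<and> affine_dim F = affine_dim S - 1"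

lemma affine_dim_eq_aff_dim:
  fixes S :: "'a::euclidean_space set"
  shows "affine_dim S = aff_dim S"
proof (cases "S = {}")
  case False
  then obtain a where a: "a \<in> S" by blast
  let ?D = "{x - y | x y. x \<in> S \<and> y \<in> S}"
  let ?T = "(\<lambda>x. - a + x) ` S"
  have "?D \<subseteq> span ?T"
  proof
    fix z assume "z \<in> ?D"
    then obtain x y where "x \<in> S" "y \<in> S" and z: "z = (- a + x) - (- a + y)" by auto
    then show "z \<in> span ?T"
      unfolding z by (intro span_diff span_base) auto
  qed
  moreover have "?T \<subseteq> ?D"
  proof
    fix z assume "z \<in> ?T"
    then obtain x where "x \<in> S" "z = x - a" by auto
    with a show "z \<in> ?D" by blast
  qed
  ultimately have "span ?D = span ?T"
    by (simp add: span_mono span_minimal subset_antisym)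
  then have "dim ?D = dim ?T"
    using dim_span[of ?D] dim_span[of ?T] by simp
  moreover have "aff_dim S = int (dim ?T)"
    using a by (intro aff_dim_eq_dim hull_inc)
  ultimately show ?thesis
    using False by (simp add: affine_dim_def)
qed (simp add: affine_dim_def)

lemma is_facet_of_iff_facet_of:
  fixes S :: "'a::euclidean_space set"
  shows "is_facet_of F S \<longleftrightarrow> F facet_of S"
  by (simp add: is_facet_of_def facet_of_def affine_dim_eq_aff_dim)

definition num_facets :: "'a::real_vector set \<Rightarrow> nat" where
  "num_facets S = card {F. is_facet_of F S}"

text \<open>Solution sets in $\mathbb{R}^q$ of finite systems of linear inequalities $a \cdot x \le b$.\<close>

definition polyhedron_in :: "nat \<Rightarrow> (nat \<Rightarrow> real) set \<Rightarrow> bool" where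
  "polyhedron_in q Q \<longleftrightarrow>
     (\<exists>A :: ((nat \<Rightarrow> real) \<times> real) set. finite A \<and>
        Q = {x \<in> coord_space q. \<forall>(a, b) \<in> A. (\<Sum>i<q. a i * x i) \<le> b})"

definition zero_one_polytope :: "(real ^ 'p) set \<Rightarrow> bool" where
  "zero_one_polytope P \<longleftrightarrow> polytope P \<and> (\<forall>v \<in> vertices P. \<forall>i. v $ i \<in> {0, 1})"

definition zero_one_polytope_in :: "nat \<Rightarrow> (nat \<Rightarrow> real) set \<Rightarrow> bool" where
  "zero_one_polytope_in q Q \<longleftrightarrow>
     polytope Q \<and> Q \<subseteq> coord_space q \<and> (\<forall>v \<in> vertices Q. \<forall>i<q. v i \<in> {0, 1})"

text \<open>The map \<open>\<pi>\<close> is defined on all sequences, but only its restriction to \<^term>\<open>coord_space q\<close>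
  matters. Every linear map on that subspace extends to all sequences, so this is no restriction.\<close>

definition extension ::
  "nat \<Rightarrow> (nat \<Rightarrow> real) set \<Rightarrow> ((nat \<Rightarrow> real) \<Rightarrow> real ^ 'p) \<Rightarrow> (real ^ 'p) set \<Rightarrow> bool" where
  "extension q Q \<pi> P \<longleftrightarrow> polyhedron_in q Q \<and> linear \<pi> \<and> \<pi> ` Q = P"

definition nice_01_extension ::
  "nat \<Rightarrow> (nat \<Rightarrow> real) set \<Rightarrow> ((nat \<Rightarrow> real) \<Rightarrow> real ^ 'p) \<Rightarrow> (real ^ 'p) set \<Rightarrow> bool" where
  "nice_01_extension q Q \<pi> P \<longleftrightarrow>
     extension q Q \<pi> P \<and>
     zero_one_polytope_in q Q \<and>
     (\<forall>w \<in> vertices Q. \<pi> w \<in> vertices P) \<and>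
     (\<forall>v \<in> vertices P. \<exists>!w. w \<in> vertices Q \<and> \<pi> w = v)"

text \<open>The minimum is taken over a nonempty set whenever \<open>P\<close> is a 0/1-polytope, since \<open>P\<close> is a
  nice 0/1-extension of itself; for other \<open>P\<close> the value is irrelevant.\<close>

definition xc_star :: "(real ^ 'p) set \<Rightarrow> nat" where
  "xc_star P = (LEAST k. \<exists>q Q \<pi>. nice_01_extension q Q \<pi> P \<and> num_facets Q = k)"

definition down :: "'p \<Rightarrow> real ^ 'p \<Rightarrow> real ^ 'p" where
  "down j x = (\<chi> i. if i = j then 0 else x $ i)"

end

theory Submission
  imports Defs
begin

text \<open>Let \<open>Q'\<close> with the projection \<open>\<pi>'\<close> be an optimal nice extension of \<open>P'\<close>, and put
  \<open>l y = (\<pi>' y)\<^sub>j\<close>, which is nonnegative on \<open>Q'\<close>. The wedge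
  \<open>Q = {(y, t). y \<in> Q', 0 \<le> t \<le> l y}\<close> projects onto \<open>conv (P' \<union> down\<^sub>j P')\<close> by replacing the
  \<open>j\<close>-th coordinate of \<open>\<pi>' y\<close> by \<open>t\<close>. Its vertices are \<open>(v, 0)\<close> and \<open>(v, l v)\<close> for the vertices
  \<open>v\<close> of \<open>Q'\<close>, and injectivity of \<open>down\<^sub>j\<close> makes them correspond to the vertices of the
  projection. A facet of \<open>Q\<close> other than the bottom \<open>t = 0\<close> and the top \<open>t = l y\<close> contains the
  whole fibre over each of its points, so it is the preimage of a facet of \<open>Q'\<close>.\<close>

subsection \<open>Dimension of faces in arbitrary real vector spaces\<close>

text \<open>The finite set \<open>K\<close> forces the maximal independent set \<open>C\<close> to
  be finite. An infinite \<open>C\<close> would have \<open>card C = 0\<close>, which bounds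
  nothing.\<close>

lemma independent_card_le_dim_of_finite_span:
  fixes V :: "'a::real_vector set"
  assumes "B \<subseteq> V" "independent B" "V \<subseteq> span K" "finite K"
  shows "card B \<le> dim V"
proof -
  obtain C where C: "B \<subseteq> C" "C \<subseteq> V" "independent C" "V \<subseteq> span C"
    using real_vector.maximal_independent_subset_extend[OF assms(1,2)] by blast
  then have "finite C"
    using real_vector.independent_span_bound[OF assms(4) C(3)] assms(3) by blast
  moreover have "card C = dim V"
    using C by (intro real_vector.basis_card_eq_dim)
  ultimately show ?thesis using C(1) card_mono by metis
qed

text \<open>A vector of \<open>C\<close> outside \<open>span A\<close> would extend a basis of
  \<open>A\<close> to an independent subset of \<open>C\<close> with more than \<open>dim C\<close>
  elements.\<close>

lemma subset_span_of_dim_le: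
  fixes A C :: "'a::real_vector set"
  assumes "A \<subseteq> C" "C \<subseteq> span K" "finite K" "dim C \<le> dim A"
  shows "C \<subseteq> span A"
proof
  fix c assume c: "c \<in> C"
  obtain B where B: "B \<subseteq> A" "independent B" "A \<subseteq> span B" "card B = dim A"
    using real_vector.basis_exists by blast
  have fB: "finite B"
    using real_vector.independent_span_bound[OF assms(3) B(2)] B(1) assms(1,2) by blast
  show "c \<in> span A"
  proof (rule ccontr)
    assume n: "c \<notin> span A"
    then have nB: "c \<notin> span B" using B(1) real_vector.span_mono by blast
    have "card (insert c B) \<le> dim C"
      using B(1,2) c assms(1) nB
      by (intro independent_card_le_dim_of_finite_span[OF _ _ assms(2,3)]
          real_vector.independent_insertI) auto
    moreover have "c \<notin> B" using nB real_vector.span_base by blast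
    ultimately show False using B(4) assms(4) fB by simp
  qed
qed

lemma dim_insert_of_finite_span:
  fixes V :: "'a::real_vector set"
  assumes "V \<subseteq> span K" "finite K" "e \<notin> span V"
  shows "dim (insert e V) = dim V + 1"
proof -
  obtain B where B: "B \<subseteq> V" "independent B" "V \<subseteq> span B" "card B = dim V"
    using real_vector.basis_exists by blast
  have fB: "finite B"
    using real_vector.independent_span_bound[OF assms(2) B(2)] B(1) assms(1) by blast
  have nB: "e \<notin> span B" using assms(3) B(1) real_vector.span_mono by blast
  moreover have "e \<notin> B" using nB real_vector.span_base by blast
  moreover have "insert e V \<subseteq> span (insert e B)"
    using B(3) real_vector.span_mono[of B "insert e B"] real_vector.span_base[of e "insert e B"] by blast
  ultimately have "dim (insert e V) = card (insert e B)"
    using B by (intro real_vector.dim_unique[of "insert e B"] real_vector.independent_insertI) auto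
  then show ?thesis using \<open>e \<notin> B\<close> fB B(4) by simp
qed

text \<open>For convex \<open>F\<close> the cone over \<open>F - F\<close> is already a subspace.\<close>

lemma span_differences_convex:
  fixes F :: "'a::real_vector set"
  assumes "convex F" "a \<in> F" "z \<in> span {x - y | x y. x \<in> F \<and> y \<in> F}"
  obtains c f g where "c \<ge> 0" "f \<in> F" "g \<in> F" "z = c *\<^sub>R (f - g)"
proof -
  have "\<exists>c f g. c \<ge> 0 \<and> f \<in> F \<and> g \<in> F \<and> z = c *\<^sub>R (f - g)"
    using assms(3)
  proof (induction rule: real_vector.span_induct_alt)
    case base
    show ?case using assms(2) by (intro exI[of _ 0] exI[of _ a]) auto
  next
    case (step k x y)
    obtain c f g where 1: "c \<ge> 0" "f \<in> F" "g \<in> F" "y = c *\<^sub>R (f - g)" using step by blast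
    obtain d u v where 2: "d \<ge> 0" "u \<in> F" "v \<in> F" "k *\<^sub>R x = d *\<^sub>R (u - v)"
    proof -
      obtain u v where uv: "x = u - v" "u \<in> F" "v \<in> F" using step by blast
      show ?thesis
      proof (cases "k \<ge> 0")
        case True then show ?thesis using that uv by blast
      next
        \<comment> \<open>A negative coefficient is absorbed by exchanging the two points of the
          difference.\<close>
        case False
        then have "k *\<^sub>R x = (-k) *\<^sub>R (v - u)" unfolding uv by (simp add: scaleR_diff_right)
        then show ?thesis using that[of "-k" v u] uv False by simp
      qed
    qed
    show ?case
    proof (cases "c + d = 0")
      case True
      then have "c = 0" "d = 0" using 1(1) 2(1) by linarith+
      then have "k *\<^sub>R x + y = 0" using 1(4) 2(4) by simp
      then show ?thesis using assms(2) by (intro exI[of _ 0] exI[of _ a]) simp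
    next
      case False
      let ?s = "c + d"
      have s: "?s > 0" using False 1 2 by simp
      \<comment> \<open>Averaging the minuends and the subtrahends with the same weights
        \<open>c / ?s\<close> and \<open>d / ?s\<close> merges two scaled differences into one with
        factor \<open>?s\<close>.\<close>
      have "(c / ?s) *\<^sub>R f + (d / ?s) *\<^sub>R u \<in> F" "(c / ?s) *\<^sub>R g + (d / ?s) *\<^sub>R v \<in> F"
        using 1 2 s by (auto intro!: convexD[OF assms(1)] simp: add_divide_distrib[symmetric])
      moreover have "k *\<^sub>R x + y =
        ?s *\<^sub>R (((c / ?s) *\<^sub>R f + (d / ?s) *\<^sub>R u) - ((c / ?s) *\<^sub>R g + (d / ?s) *\<^sub>R v))"
        using s 1 2 by (simp add: scaleR_diff_right scaleR_add_right)
      ultimately show ?thesis using s by (intro exI[of _ ?s]) (meson less_imp_le)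
    qed
  qed
  then show ?thesis using that by blast
qed

text \<open>Rewrite \<open>x - a = c (f - g)\<close> as \<open>a + c f = x + c g\<close>. Divided by
  \<open>1 + c\<close>, this is a point of \<open>F\<close> by convexity and a point between
  \<open>x\<close> and \<open>g\<close>, so the face property puts \<open>x\<close> into
  \<open>F\<close>.\<close>

lemma face_of_eq_of_span_differences:
  fixes S :: "'a::real_vector set"
  assumes "F face_of S" "F \<noteq> {}"
    and sp: "{x - y | x y. x \<in> S \<and> y \<in> S} \<subseteq> span {x - y | x y. x \<in> F \<and> y \<in> F}"
  shows "F = S"
proof
  show FS: "F \<subseteq> S" using assms(1) by (rule face_of_imp_subset)
  have cF: "convex F" using assms(1) by (rule face_of_imp_convex)
  obtain a where a: "a \<in> F" using assms(2) by blast
  show "S \<subseteq> F"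
  proof
    fix x assume x: "x \<in> S"
    have "x - a \<in> span {x - y | x y. x \<in> F \<and> y \<in> F}" using sp x a FS by blast
    then obtain c f g where c: "c \<ge> 0" "f \<in> F" "g \<in> F" "x - a = c *\<^sub>R (f - g)"
      using span_differences_convex[OF cF a] by blast
    show "x \<in> F"
    \<comment> \<open>Here the segment degenerates, but \<open>x\<close> equals \<open>a\<close> or
      \<open>g\<close>.\<close>
    proof (cases "c = 0 \<or> x = g")
      case True then show ?thesis using c a by auto
    next
      case False
      let ?m = "(1 / (1 + c)) *\<^sub>R a + (c / (1 + c)) *\<^sub>R f"
      have "?m \<in> F"
        using a c by (intro convexD[OF cF]) (auto simp: add_divide_distrib[symmetric])
      moreover have "?m \<in> open_segment x g"
      proof -
        have "?m = (1 / (1 + c)) *\<^sub>R (a + c *\<^sub>R f)" by (simp add: scaleR_add_right)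
        also have "a + c *\<^sub>R f = x + c *\<^sub>R g" using c(4) by (simp add: algebra_simps)
        also have "(1 / (1 + c)) *\<^sub>R (x + c *\<^sub>R g) =
            (1 - c / (1 + c)) *\<^sub>R x + (c / (1 + c)) *\<^sub>R g"
        proof -
          have "1 - c / (1 + c) = 1 / (1 + c)" using c(1) by (simp add: field_simps)
          then show ?thesis by (simp add: scaleR_add_right)
        qed
        finally have *: "?m = (1 - c / (1 + c)) *\<^sub>R x + (c / (1 + c)) *\<^sub>R g" .
        show ?thesis
          unfolding in_segment using False c(1) *
          by (intro conjI exI[of _ "c / (1 + c)"]) auto
      qed
      ultimately show ?thesis
        using face_ofD[OF assms(1)] x c(3) FS by blast
    qed
  qed
qed

text \<open>This serves to show that facets are maximal proper faces. The differences of
  \<open>F\<close> are among those of \<open>S\<close> and have at least the same dimension, so in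
  finite dimension they span them.\<close>

lemma face_of_eq_of_affine_dim_le:
  fixes S :: "'a::real_vector set"
  assumes F: "F face_of S" "F \<noteq> {}" and S: "S \<subseteq> span K" "finite K"
    and le: "affine_dim S \<le> affine_dim F"
  shows "F = S"
proof (rule face_of_eq_of_span_differences[OF F])
  have FS: "F \<subseteq> S" using F(1) by (rule face_of_imp_subset)
  then have "dim {x - y | x y. x \<in> S \<and> y \<in> S} \<le> dim {x - y | x y. x \<in> F \<and> y \<in> F}"
    using le F(2) by (auto simp: affine_dim_def split: if_splits)
  moreover have "{x - y | x y. x \<in> F \<and> y \<in> F} \<subseteq> {x - y | x y. x \<in> S \<and> y \<in> S}"
    using FS by blast
  moreover have "{x - y | x y. x \<in> S \<and> y \<in> S} \<subseteq> span K"
    using S(1) real_vector.span_diff by blast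
  ultimately show "{x - y | x y. x \<in> S \<and> y \<in> S} \<subseteq> span {x - y | x y. x \<in> F \<and> y \<in> F}"
    by (rule subset_span_of_dim_le[OF _ _ S(2), rotated 2])
qed

section \<open>Faces of a convex hull\<close>

text \<open>The set \<open>?K\<close> is convex: a segment with ends in \<open>?K\<close> that meets
  \<open>F\<close> in its interior has both ends in \<open>F\<close>, hence in the hull of
  \<open>F \<inter> V\<close>. As \<open>?K\<close> contains \<open>V\<close>, it is all of
  \<open>convex hull V\<close>, so \<open>F\<close> has no points outside that smaller hull.\<close>

lemma face_of_convex_hull_eq:
  fixes V :: "'a::real_vector set"
  assumes "F face_of convex hull V"
  shows "F = convex hull (F \<inter> V)"
proof (rule subset_antisym)
  have cF: "convex F" using assms by (rule face_of_imp_convex)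
  show sub: "convex hull (F \<inter> V) \<subseteq> F" using cF by (simp add: hull_minimal)
  let ?S = "convex hull V"
  let ?K = "(?S - F) \<union> convex hull (F \<inter> V)"
  have KS: "?K \<subseteq> ?S" using hull_mono[of "F \<inter> V" V convex] by auto
  have seg: "z \<in> convex hull C" if "x \<in> convex hull C" "y \<in> convex hull C" "z \<in> open_segment x y"
    for C :: "'a set" and x y z
    using that convex_contains_open_segment[of "convex hull C"] convex_convex_hull by blast
  have "convex ?K"
  proof (rule convex_contains_open_segment[THEN iffD2], intro ballI subsetI)
    fix x y z assume x: "x \<in> ?K" and y: "y \<in> ?K" and z: "z \<in> open_segment x y"
    have zS: "z \<in> ?S" using seg[OF _ _ z] x y KS by blast
    show "z \<in> ?K"
    proof (cases "z \<in> F")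
      case True
      then have "x \<in> F" "y \<in> F" using face_ofD[OF assms z] x y KS by blast+
      then show ?thesis using seg[OF _ _ z] x y by blast
    qed (use zS in blast)
  qed
  moreover have "V \<subseteq> ?K" using hull_subset[of V convex] hull_subset[of "F \<inter> V" convex] by blast
  ultimately have "?S \<subseteq> ?K" by (simp add: hull_minimal)
  then show "F \<subseteq> convex hull (F \<inter> V)" using face_of_imp_subset[OF assms] by blast
qed

text \<open>A face is determined by the generators it contains. Finiteness makes the cardinalities
  in the facet count meaningful.\<close>

lemma finite_faces_of_polytope:
  fixes S :: "'a::real_vector set"
  assumes "polytope S"
  shows "finite {F. F face_of S}"
proof -
  obtain V where V: "finite V" "S = convex hull V" using assms polytope_def by blast
  have "{F. F face_of S} \<subseteq> (hull) convex ` Pow V"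
    using face_of_convex_hull_eq V(2) by blast
  then show ?thesis using V(1) finite_subset by blast
qed

subsection \<open>Wedges\<close>

text \<open>Inside a segment, \<open>h\<close> is a combination of two nonnegative end values with
  positive weights, so it vanishes only if both do. With \<open>h\<close> equal to \<open>t\<close>
  and to \<open>l - t\<close> this yields the bottom and the top face of the wedge.\<close>

lemma face_of_zero_set_nonneg:
  assumes "linear h" "convex S" "\<And>x. x \<in> S \<Longrightarrow> 0 \<le> h x"
  shows "(S \<inter> {x. h x = (0::real)}) face_of S"
  unfolding face_of_def
proof (intro conjI ballI impI)
  show "convex (S \<inter> {x. h x = 0})"
    using assms(2) convex_linear_vimage[OF assms(1), of "{0}"]
    by (intro convex_Int) (auto simp: vimage_def)
  show "S \<inter> {x. h x = 0} \<subseteq> S" by blast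
  fix a b x assume h: "a \<in> S" "b \<in> S" "x \<in> S \<inter> {x. h x = 0}" "x \<in> open_segment a b"
  obtain u where u: "0 < u" "u < 1" "x = (1 - u) *\<^sub>R a + u *\<^sub>R b"
    using h(4) by (auto simp: in_segment)
  have "0 = (1 - u) * h a + u * h b"
    using h(3) by (simp add: u(3) linear_add[OF assms(1)] linear_scale[OF assms(1)])
  moreover have "0 \<le> (1 - u) * h a" "0 \<le> u * h b" using u assms(3) h by simp_all
  ultimately have "(1 - u) * h a = 0" "u * h b = 0" by linarith+
  then show "a \<in> S \<inter> {x. h x = 0}" "b \<in> S \<inter> {x. h x = 0}" using u h by auto
qed

text \<open>The new coordinate is \<open>t\<close>, and \<open>e\<close> is its unit vector, so that the base \<open>B\<close> lives in the same
  space as the wedge \<open>W\<close> and is literally one of its faces.\<close>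

locale wedge =
  fixes t l :: "'a::real_vector \<Rightarrow> real" and e :: 'a and B :: "'a set"
  assumes linear_t: "linear t" and linear_l: "linear l"
    and t_e: "t e = 1" and l_e: "l e = 0"
    and t_base: "y \<in> B \<Longrightarrow> t y = 0" and l_base: "y \<in> B \<Longrightarrow> 0 \<le> l y"
    and polytope_base: "polytope B"
begin

definition proj :: "'a \<Rightarrow> 'a" where "proj x = x - t x *\<^sub>R e"

definition lift :: "'a \<Rightarrow> 'a" where "lift y = y + l y *\<^sub>R e"

text \<open>The bound can read \<open>l x\<close> in place of \<open>l (proj x)\<close> because
  \<open>l e = 0\<close>.\<close>

definition W :: "'a set" where "W = {x. proj x \<in> B \<and> 0 \<le> t x \<and> t x \<le> l x}"

lemmas t_simps = linear_add[OF linear_t] linear_diff[OF linear_t] linear_scale[OF linear_t]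
lemmas l_simps = linear_add[OF linear_l] linear_diff[OF linear_l] linear_scale[OF linear_l]

lemma linear_proj: "linear proj"
  by (rule linearI) (simp_all add: proj_def t_simps algebra_simps)

lemma linear_lift: "linear lift"
  by (rule linearI) (simp_all add: lift_def l_simps algebra_simps)

text \<open>The map is a shear along \<open>e\<close>. It leaves \<open>l\<close> unchanged because
  \<open>l e = 0\<close>, so it can be undone on the whole space.\<close>

lemma inj_lift: "inj lift"
proof (rule inj_on_inverseI)
  fix y show "(\<lambda>x. x - l x *\<^sub>R e) (lift y) = y" by (simp add: lift_def l_simps l_e)
qed

lemma t_proj: "t (proj x) = 0" by (simp add: proj_def t_simps t_e)

lemma l_proj: "l (proj x) = l x" by (simp add: proj_def l_simps l_e)

lemma proj_base: "y \<in> B \<Longrightarrow> proj y = y" by (simp add: proj_def t_base)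

lemma proj_proj: "proj (proj x) = proj x" by (simp add: proj_def[of "proj x"] t_proj)

lemma t_lift: "y \<in> B \<Longrightarrow> t (lift y) = l y" by (simp add: lift_def t_simps t_e t_base)

lemma l_lift: "l (lift y) = l y" by (simp add: lift_def l_simps l_e)

lemma proj_lift: "y \<in> B \<Longrightarrow> proj (lift y) = y"
  unfolding proj_def[of "lift y"] by (simp add: t_lift) (simp add: lift_def)

lemma convex_base: "convex B" using polytope_base by (rule polytope_imp_convex)

lemma convex_W: "convex W"
  unfolding W_def convex_def
proof (safe)
  fix x y and u v :: real
  assume h: "proj x \<in> B" "0 \<le> t x" "t x \<le> l x" "proj y \<in> B" "0 \<le> t y" "t y \<le> l y"
    and uv: "0 \<le> u" "0 \<le> v" "u + v = 1"
  show "proj (u *\<^sub>R x + v *\<^sub>R y) \<in> B"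
    using convexD[OF convex_base h(1,4) uv]
    by (simp add: linear_add[OF linear_proj] linear_scale[OF linear_proj])
  show "0 \<le> t (u *\<^sub>R x + v *\<^sub>R y)" using h uv by (simp add: t_simps)
  show "t (u *\<^sub>R x + v *\<^sub>R y) \<le> l (u *\<^sub>R x + v *\<^sub>R y)"
    using h uv by (simp add: t_simps l_simps add_mono mult_left_mono)
qed

lemma base_eq: "B = W \<inter> {x. t x = 0}"
  by (auto simp: W_def proj_base t_base l_base) (simp add: proj_def)

lemma base_subset: "B \<subseteq> W" using base_eq by blast

lemma lift_base_eq: "lift ` B = W \<inter> {x. t x = l x}"
proof (intro equalityI subsetI)
  fix x assume "x \<in> W \<inter> {x. t x = l x}"
  then have "proj x \<in> B" "x = lift (proj x)"
    unfolding lift_def l_proj by (auto simp: W_def proj_def)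
  then show "x \<in> lift ` B" by blast
qed (auto simp: W_def t_lift l_lift proj_lift l_base)

lemma base_face: "B face_of W"
  using face_of_zero_set_nonneg[OF linear_t convex_W] base_eq by (simp add: W_def)

lemma lift_base_face: "lift ` B face_of W"
proof -
  have "W \<inter> {x. l x - t x = 0} face_of W"
    by (rule face_of_zero_set_nonneg[OF linear_compose_sub[OF linear_l linear_t] convex_W]) (simp add: W_def)
  moreover have "W \<inter> {x. l x - t x = 0} = lift ` B" unfolding lift_base_eq by auto
  ultimately show ?thesis by simp
qed

lemma mem_open_fibre:
  assumes "proj x \<in> B" "0 < t x" "t x < l x"
  shows "x \<in> open_segment (proj x) (lift (proj x))"
proof -
  \<comment> \<open>The fibre runs from height 0 to height \<open>l x\<close>, so height
    \<open>t x\<close> corresponds to the segment parameter \<open>t x / l x\<close>.\<close>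
  have "x = (1 - t x / l x) *\<^sub>R proj x + (t x / l x) *\<^sub>R lift (proj x)"
    using assms by (simp add: lift_def l_proj algebra_simps) (simp add: proj_def)
  moreover have "proj x \<noteq> lift (proj x)"
    using assms t_lift[OF assms(1)] by (auto simp: t_proj l_proj)
  ultimately show ?thesis
    unfolding in_segment using assms by (intro conjI exI[of _ "t x / l x"]) auto
qed

lemma mem_fibre:
  assumes "x \<in> W"
  shows "x \<in> closed_segment (proj x) (lift (proj x))"
proof -
  have p: "proj x \<in> B" "0 \<le> t x" "t x \<le> l x" using assms by (auto simp: W_def)
  consider "0 < t x" "t x < l x" | "t x = 0" | "t x = l x" using p by linarith
  then show ?thesis
  proof cases
    case 1 then show ?thesis using mem_open_fibre p segment_open_subset_closed by blast
  next
    case 2 then have "x = proj x" by (simp add: proj_def)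
    then show ?thesis by (metis ends_in_segment(1))
  next
    case 3 then have "x = lift (proj x)" unfolding lift_def l_proj by (simp add: proj_def)
    then show ?thesis by (metis ends_in_segment(2))
  qed
qed

section \<open>Generators and vertices of the wedge\<close>

text \<open>Every fibre is a segment from a point of the hull of \<open>V\<close> to a point of the
  hull of its lifted copy, so \<open>V\<close> and this copy generate \<open>W\<close>.\<close>

lemma polytope_W: "polytope W"
proof -
  obtain V where V: "finite V" "B = convex hull V" using polytope_base polytope_def by blast
  have TV: "lift ` B = convex hull (lift ` V)"
    unfolding V(2) by (rule convex_hull_linear_image[OF linear_lift])
  have "W = convex hull (V \<union> lift ` V)"
  proof
    have "V \<subseteq> W" "lift ` V \<subseteq> W"
      using base_subset lift_base_eq V(2) hull_subset[of V convex] by blast+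
    then show "convex hull (V \<union> lift ` V) \<subseteq> W" by (simp add: hull_minimal convex_W)
    show "W \<subseteq> convex hull (V \<union> lift ` V)"
    proof
      fix x assume x: "x \<in> W"
      then have "proj x \<in> B" by (simp add: W_def)
      then have "proj x \<in> convex hull (V \<union> lift ` V)" "lift (proj x) \<in> convex hull (V \<union> lift ` V)"
        using V(2) TV hull_mono[of V "V \<union> lift ` V" convex]
          hull_mono[of "lift ` V" "V \<union> lift ` V" convex] by blast+
      then show "x \<in> convex hull (V \<union> lift ` V)"
        using mem_fibre[OF x] closed_segment_subset[OF _ _ convex_convex_hull] by blast
    qed
  qed
  then show ?thesis using V(1) polytope_convex_hull by (metis finite_UnI finite_imageI)
qed

text \<open>A vertex cannot lie strictly inside its fibre, so it is in the bottom or the top face.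
  The extreme points of a face are those of \<open>W\<close> that lie in it, and the injective
  linear map \<open>lift\<close> carries those of \<open>B\<close> to those of the top.\<close>

lemma vertices_W: "vertices W = vertices B \<union> lift ` vertices B"
proof -
  have ex: "lift v extreme_point_of lift ` B \<longleftrightarrow> v extreme_point_of B" for v
    using face_of_linear_image[OF linear_lift inj_lift, of "{v}" B] by (simp add: face_of_singleton)
  show ?thesis
  proof (intro equalityI subsetI)
    fix x assume "x \<in> vertices W"
    then have x: "x extreme_point_of W" by (simp add: vertices_def)
    then have xW: "x \<in> W" by (simp add: extreme_point_of_def)
    then have "proj x \<in> B" by (simp add: W_def)
    then have "proj x \<in> W" "lift (proj x) \<in> W" using base_subset lift_base_eq by blast+
    then have "x \<notin> open_segment (proj x) (lift (proj x))"
      using x by (auto simp: extreme_point_of_def)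
    then have "\<not> (0 < t x \<and> t x < l x)" using mem_open_fibre xW by (auto simp: W_def)
    then have "t x = 0 \<or> t x = l x" using xW by (auto simp: W_def)
    then have "x \<in> B \<or> x \<in> lift ` B" using xW lift_base_eq base_eq by blast
    then show "x \<in> vertices B \<union> lift ` vertices B"
    proof
      assume "x \<in> B" then show ?thesis
        using x extreme_point_of_face[OF base_face] by (auto simp: vertices_def)
    next
      assume "x \<in> lift ` B"
      then obtain v where v: "x = lift v" by blast
      then have "v extreme_point_of B"
        using \<open>x \<in> lift ` B\<close> x extreme_point_of_face[OF lift_base_face, of x] ex by blast
      then show ?thesis using v by (auto simp: vertices_def)
    qed
  next
    fix x assume "x \<in> vertices B \<union> lift ` vertices B"
    then have "x extreme_point_of B \<or> x extreme_point_of lift ` B"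
      using ex by (auto simp: vertices_def)
    then show "x \<in> vertices W"
      using extreme_point_of_face[OF base_face] extreme_point_of_face[OF lift_base_face]
      by (auto simp: vertices_def)
  qed
qed

section \<open>Dimension and facets of the wedge\<close>

lemma finite_span_W: obtains K where "finite K" "W \<subseteq> span K"
proof -
  obtain V where V: "finite V" "W = convex hull V" using polytope_W polytope_def by blast
  then show ?thesis using that convex_hull_subset_span by blast
qed

text \<open>A face not contained in bottom or top has a point \<open>c\<close> strictly inside its fibre. For \<open>x \<in> F\<close> the
  midpoint of \<open>x\<close> and \<open>c\<close> is then strictly inside its fibre as well, so that fibre lies in \<open>F\<close>; it
  contains the midpoint of \<open>z\<close> and \<open>c\<close>, hence \<open>z \<in> F\<close>.\<close>

lemma face_saturated:
  assumes F: "F face_of W" and nB: "\<not> F \<subseteq> B" and nT: "\<not> F \<subseteq> lift ` B"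
    and x: "x \<in> F" and z: "z \<in> W" and xz: "proj z = proj x"
  shows "z \<in> F"
proof -
  have FW: "F \<subseteq> W" and cF: "convex F"
    using F face_of_imp_subset face_of_imp_convex by blast+
  have conv: "midpoint a b \<in> F" if "a \<in> F" "b \<in> F" for a b
    using that cF midpoint_in_closed_segment closed_segment_subset by blast
  obtain a where a: "a \<in> F" "0 < t a"
    using nB FW base_eq by (force simp: W_def)
  obtain b where b: "b \<in> F" "t b < l b"
    using nT FW lift_base_eq by (force simp: W_def)
  have W: "proj y \<in> B" "0 \<le> t y" "t y \<le> l y" if "y \<in> F" for y
    using that FW by (auto simp: W_def)
  have mid: "t (midpoint a b) = (t a + t b) / 2" "l (midpoint a b) = (l a + l b) / 2" for a b
    by (simp_all add: midpoint_def t_simps l_simps)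
  let ?c = "midpoint a b"
  have c: "?c \<in> F" "0 < t ?c" "t ?c < l ?c"
    using conv[OF a(1) b(1)] a b W[OF a(1)] W[OF b(1)] by (simp_all add: mid)
  let ?m = "midpoint x ?c"
  have m: "?m \<in> F" "0 < t ?m" "t ?m < l ?m"
    using conv[OF x c(1)] W[OF x] c(2,3) by (simp_all add: mid[of x])
  let ?n = "midpoint z ?c"
  have pn: "proj ?n = proj ?m"
    using xz by (simp add: midpoint_def linear_add[OF linear_proj] linear_scale[OF linear_proj])
  have pm: "proj ?m \<in> B" using W[OF m(1)] by blast
  have "proj ?m \<in> W" "lift (proj ?m) \<in> W" using pm base_subset lift_base_eq by blast+
  then have "proj ?m \<in> F" "lift (proj ?m) \<in> F"
    using face_ofD[OF F mem_open_fibre[OF pm m(2,3)]] m(1) by blast+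
  moreover have "?n \<in> W"
    using convex_W z c(1) FW midpoint_in_closed_segment closed_segment_subset by blast
  ultimately have nF: "?n \<in> F"
    using mem_fibre[of ?n] closed_segment_subset[OF _ _ cF] unfolding pn by blast
  show "z \<in> F"
  proof (cases "z = ?c")
    case False
    then have "?n \<in> open_segment z ?c" by simp
    then show ?thesis using face_ofD[OF F] z c(1) FW nF by blast
  qed (use c in simp)
qed

text \<open>The differences of \<open>S\<close> are spanned by those of \<open>S \<inter> B\<close>
  and \<open>e\<close>, and the ends of the fibre over \<open>y\<close> supply \<open>e\<close> as a
  multiple of \<open>lift y - y\<close>. The direction \<open>e\<close> is new because
  \<open>t\<close> vanishes on differences of \<open>B\<close> while \<open>t e = 1\<close>.\<close>

lemma affine_dim_saturated:
  assumes S: "S \<subseteq> W" "\<And>x. x \<in> S \<Longrightarrow> proj x \<in> S"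
    and y: "y \<in> S" "y \<in> B" "lift y \<in> S" "l y > 0"
  shows "affine_dim S = affine_dim (S \<inter> B) + 1"
proof -
  let ?D = "\<lambda>S. {x - y | x y. x \<in> S \<and> y \<in> S}"
  have pB: "proj x \<in> S \<inter> B" if "x \<in> S" for x using that S by (auto simp: W_def)
  have "?D S \<subseteq> span (insert e (?D (S \<inter> B)))"
  proof
    fix d assume "d \<in> ?D S"
    then obtain u v where uv: "u \<in> S" "v \<in> S" "d = u - v" by blast
    then have d: "d = (proj u - proj v) + (t u - t v) *\<^sub>R e"
      by (simp add: proj_def algebra_simps)
    have "proj u - proj v \<in> span (insert e (?D (S \<inter> B)))"
      using pB uv by (intro real_vector.span_base) blast
    then show "d \<in> span (insert e (?D (S \<inter> B)))"
      unfolding d by (intro real_vector.span_add real_vector.span_scale)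
        (auto intro: real_vector.span_base)
  qed
  moreover have "insert e (?D (S \<inter> B)) \<subseteq> span (?D S)"
  proof -
    have "lift y - y \<in> ?D S" using y by blast
    then have "(1 / l y) *\<^sub>R (lift y - y) \<in> span (?D S)"
      by (intro real_vector.span_scale real_vector.span_base)
    then have "e \<in> span (?D S)" using y by (simp add: lift_def)
    moreover have "?D (S \<inter> B) \<subseteq> span (?D S)"
      by (rule order_trans[OF _ real_vector.span_superset]) blast
    ultimately show ?thesis by blast
  qed
  ultimately have "span (?D S) = span (insert e (?D (S \<inter> B)))"
    by (intro subset_antisym real_vector.span_minimal real_vector.subspace_span)
  then have "dim (?D S) = dim (insert e (?D (S \<inter> B)))" by (rule real_vector.span_eq_dim)
  also have "\<dots> = dim (?D (S \<inter> B)) + 1"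
  proof -
    obtain K where K: "finite K" "W \<subseteq> span K" by (rule finite_span_W)
    have 1: "?D (S \<inter> B) \<subseteq> span K"
      using K(2) S(1) real_vector.span_diff by blast
    have "span (?D (S \<inter> B)) \<subseteq> {x. t x = 0}"
      using linear_subspace_kernel[OF linear_t]
      by (intro real_vector.span_minimal) (auto simp: t_simps t_base)
    then have "e \<notin> span (?D (S \<inter> B))" using t_e by auto
    then show ?thesis using dim_insert_of_finite_span[OF 1 K(1)] by blast
  qed
  finally show ?thesis using y by (auto simp: affine_dim_def)
qed

lemma num_facets_W: "num_facets W \<le> num_facets B + 2"
proof (cases "\<exists>y\<in>B. l y > 0")
  \<comment> \<open>Here \<open>l\<close> vanishes on \<open>B\<close>, and the wedge collapses to
    its base.\<close>
  case False
  then have "t x = 0" if "x \<in> W" for x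
    using that l_proj[of x] unfolding W_def by force
  then have "W = B" using base_eq by blast
  then show ?thesis by simp
next
  case True
  then obtain y where y: "y \<in> B" "l y > 0" by blast
  obtain K where K: "finite K" "W \<subseteq> span K" by (rule finite_span_W)
  have inW: "lift z \<in> W" "z \<in> W" if "z \<in> B" for z using that base_subset lift_base_eq by blast+
  have projW: "proj x \<in> W" if "x \<in> W" for x using that base_subset by (auto simp: W_def)
  have WB: "W \<inter> B = B" using base_subset by blast
  have dimW: "affine_dim W = affine_dim B + 1"
    using affine_dim_saturated[of W y] y inW projW WB by simp
  \<comment> \<open>Facets are maximal proper faces: a face \<open>G\<close> other than
    \<open>W\<close> has dimension below that of \<open>W\<close>, hence at most that of
    \<open>F\<close>.\<close>
  have face_eq: "F = G"
    if "is_facet_of F W" "F \<subseteq> G" "G face_of W" "G \<noteq> W" for F G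
  proof -
    have F: "F face_of W" "F \<noteq> {}" "affine_dim F = affine_dim W - 1"
      using that by (auto simp: is_facet_of_def)
    have GW: "G \<subseteq> W" using that(3) face_of_imp_subset by blast
    have "\<not> affine_dim W \<le> affine_dim G"
      using face_of_eq_of_affine_dim_le[OF that(3) _ K(2,1)] that F(2) by blast
    then show ?thesis
      using face_of_subset[OF F(1) that(2) GW] F K GW
      by (intro face_of_eq_of_affine_dim_le[of F G K]) auto
  qed
  let ?A = "{F. is_facet_of F W} - {B, lift ` B}"
  \<comment> \<open>By maximality, a facet other than bottom and top is contained in neither, so
    \<open>face_saturated\<close> applies.\<close>
  have sat: "z \<in> F" if "F \<in> ?A" "x \<in> F" "z \<in> W" "proj z = proj x" for F x z
  proof -
    have "B \<noteq> W" using dimW by auto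
    moreover have "lift ` B \<noteq> W" unfolding lift_base_eq using y inW(2)[OF y(1)] t_base by force
    ultimately have "\<not> F \<subseteq> B" "\<not> F \<subseteq> lift ` B"
      using that(1) face_eq base_face lift_base_face by blast+
    moreover have "F face_of W" using that by (simp add: is_facet_of_def)
    ultimately show ?thesis using face_saturated that by blast
  qed
  have AW: "F \<subseteq> W" if "F \<in> ?A" for F
    using that face_of_imp_subset by (auto simp: is_facet_of_def)
  have projA: "proj x \<in> F \<inter> B" if "F \<in> ?A" "x \<in> F" for F x
  proof -
    have "x \<in> W" using AW that by blast
    then show ?thesis using sat[OF that projW proj_proj] by (auto simp: W_def)
  qed
  \<comment> \<open>Saturation recovers \<open>F\<close> from its trace: a point of \<open>W\<close>
    is in \<open>F\<close> exactly when its projection is in \<open>F \<inter> B\<close>.\<close>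
  have "inj_on (\<lambda>F. F \<inter> B) ?A"
  proof (rule inj_onI)
    have "F \<subseteq> G" if "F \<in> ?A" "G \<in> ?A" "F \<inter> B = G \<inter> B" for F G
    proof
      fix x assume x: "x \<in> F"
      then have "proj x \<in> G" using projA[OF that(1)] that(3) by blast
      then show "x \<in> G" using sat[OF that(2), of "proj x" x] x AW[OF that(1)] proj_proj by auto
    qed
    then show "F = G" if "F \<in> ?A" "G \<in> ?A" "F \<inter> B = G \<inter> B" for F G
      using that by (metis subset_antisym)
  qed
  moreover have "(\<lambda>F. F \<inter> B) ` ?A \<subseteq> {F. is_facet_of F B}"
  proof
    fix H assume "H \<in> (\<lambda>F. F \<inter> B) ` ?A"
    then obtain F where F: "F \<in> ?A" "H = F \<inter> B" by blast
    have Ff: "F face_of W" "F \<noteq> {}" "affine_dim F = affine_dim W - 1"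
      using F by (auto simp: is_facet_of_def)
    have "F \<inter> B face_of B"
      using face_of_Int[OF Ff(1) base_face] by (rule face_of_subset) (use base_subset in auto)
    moreover have "F \<inter> B \<noteq> {}" using projA[OF F(1)] Ff(2) by blast
    \<comment> \<open>The facet contains both ends of a fibre of positive length, so intersecting
      with \<open>B\<close> lowers its dimension by one, as it does for \<open>W\<close>.
      Codimension one is therefore preserved.\<close>
    moreover have "affine_dim F = affine_dim (F \<inter> B) + 1"
    proof -
      have "B \<noteq> W" using dimW by auto
      then have "\<not> F \<subseteq> B" using face_eq[of F B] F(1) base_face by blast
      then obtain x where x: "x \<in> F" "x \<notin> B" by blast
      then have "t x > 0" using base_eq AW[OF F(1)] by (force simp: W_def)
      then have "l (proj x) > 0" using AW[OF F(1)] x by (force simp: W_def l_proj)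
      moreover have px: "proj x \<in> F \<inter> B" using projA F(1) x by blast
      moreover have "lift (proj x) \<in> F"
        using sat[OF F(1) x(1), of "lift (proj x)"] inW px proj_lift by auto
      ultimately show ?thesis
        using AW[OF F(1)] projA[OF F(1)] by (intro affine_dim_saturated[of F "proj x"]) auto
    qed
    ultimately show "H \<in> {F. is_facet_of F B}"
      using F(2) Ff(3) dimW by (auto simp: is_facet_of_def)
  qed
  moreover have "finite {F. is_facet_of F B}"
    using finite_faces_of_polytope[OF polytope_base]
    by (rule rev_finite_subset) (auto simp: is_facet_of_def)
  ultimately have "card ?A \<le> num_facets B"
    unfolding num_facets_def by (metis card_image card_mono)
  moreover have "finite {F. is_facet_of F W}"
    using finite_faces_of_polytope[OF polytope_W]
    by (rule rev_finite_subset) (auto simp: is_facet_of_def)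
  moreover have "card {B, lift ` B} \<le> 2" by (simp add: card_insert_if)
  ultimately show ?thesis
    unfolding num_facets_def
    using diff_card_le_card_Diff[of "{B, lift ` B}" "{F. is_facet_of F W}"] by simp
qed

end

subsection \<open>Nice extensions\<close>

text \<open>The values 0 and 1 are extreme in the unit interval, so the ends of a segment through
  the interior of which \<open>v\<close> passes agree in every coordinate. The value 1 is treated by
  passing to \<open>1 - a $ i\<close> and \<open>1 - b $ i\<close>.\<close>

lemma zero_one_vertex:
  fixes S :: "(real ^ 'p) set"
  assumes "v \<in> S" "\<And>i. v $ i \<in> {0, 1}" and S: "\<And>x i. x \<in> S \<Longrightarrow> 0 \<le> x $ i \<and> x $ i \<le> 1"
  shows "v \<in> vertices S"
proof -
  have "v \<notin> open_segment a b" if ab: "a \<in> S" "b \<in> S" for a b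
  proof
    assume "v \<in> open_segment a b"
    then obtain u where u: "a \<noteq> b" "0 < u" "u < 1" "v = (1 - u) *\<^sub>R a + u *\<^sub>R b"
      by (auto simp: in_segment)
    have "a $ i = b $ i" for i
    proof -
      have v: "v $ i = (1 - u) * a $ i + u * b $ i" using u(4) by simp
      have *: "0 \<le> (1 - u) * a $ i" "0 \<le> u * b $ i"
        "0 \<le> (1 - u) * (1 - a $ i)" "0 \<le> u * (1 - b $ i)"
        using u S ab by simp_all
      consider "v $ i = 0" | "v $ i = 1" using assms(2)[of i] by auto
      then show ?thesis
      proof cases
        case 1
        then have "(1 - u) * a $ i = 0" "u * b $ i = 0" using v * by linarith+
        then show ?thesis using u by simp
      next
        case 2
        then have "(1 - u) * (1 - a $ i) + u * (1 - b $ i) = 0"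
          using v by (simp add: algebra_simps)
        then have "(1 - u) * (1 - a $ i) = 0" "u * (1 - b $ i) = 0" using * by linarith+
        then show ?thesis using u by simp
      qed
    qed
    then show False using u(1) by (simp add: vec_eq_iff)
  qed
  then show ?thesis using assms(1) by (simp add: vertices_def extreme_point_of_def)
qed

lemma polytope_hull_vertices:
  fixes P :: "'a::euclidean_space set"
  assumes "polytope P"
  shows "P = convex hull vertices P"
  using Krein_Milman_Minkowski[OF polytope_imp_compact[OF assms] polytope_imp_convex[OF assms]]
  by (simp add: vertices_def)

lemma convex_unit_cube: "convex {x :: real ^ 'p. \<forall>i. 0 \<le> x $ i \<and> x $ i \<le> 1}"
proof -
  have "{x :: real ^ 'p. \<forall>i. 0 \<le> x $ i \<and> x $ i \<le> 1} = cbox 0 1"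
    by (auto simp: mem_box_cart)
  then show ?thesis by simp
qed

lemma zero_one_polytope_unit_cube:
  assumes "zero_one_polytope P" "x \<in> P"
  shows "0 \<le> x $ i \<and> x $ i \<le> 1"
proof -
  have "0 \<le> v $ k \<and> v $ k \<le> 1" if "v \<in> vertices P" for v k
  proof -
    have "v $ k = 0 \<or> v $ k = 1" using assms(1) that by (simp add: zero_one_polytope_def)
    then show ?thesis by auto
  qed
  then have "vertices P \<subseteq> {x. \<forall>i. 0 \<le> x $ i \<and> x $ i \<le> 1}" by blast
  then have "convex hull vertices P \<subseteq> {x. \<forall>i. 0 \<le> x $ i \<and> x $ i \<le> 1}"
    by (rule hull_minimal) (rule convex_unit_cube)
  then show ?thesis
    using assms polytope_hull_vertices[of P] by (auto simp: zero_one_polytope_def)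
qed

lemma linear_down: "linear (down j)"
  by (rule linearI) (auto simp: down_def vec_eq_iff)

lemma vertices_linear_image:
  fixes f :: "'a::real_vector \<Rightarrow> 'b::real_vector"
  assumes "linear f" "inj f"
  shows "vertices (f ` S) = f ` vertices S"
proof -
  have "f v \<in> vertices (f ` S) \<longleftrightarrow> v \<in> vertices S" for v
    using face_of_linear_image[OF assms, of "{v}" S] by (simp add: face_of_singleton vertices_def)
  moreover have "vertices (f ` S) \<subseteq> f ` S" by (auto simp: vertices_def extreme_point_of_def)
  ultimately show ?thesis by blast
qed

section \<open>A 0/1-polytope as its own nice extension\<close>

lemma polyhedron_halfspaces:
  fixes P :: "'a::euclidean_space set"
  assumes "polyhedron P"
  obtains H where "finite H" "P = {x. \<forall>(a, b) \<in> H. a \<bullet> x \<le> b}"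
proof -
  obtain F where F: "finite F" "P = \<Inter>F" "\<forall>h\<in>F. \<exists>a b. a \<noteq> 0 \<and> h = {x. a \<bullet> x \<le> b}"
    using assms polyhedron_def by metis
  then obtain a b where ab: "\<forall>h\<in>F. h = {x. a h \<bullet> x \<le> b h}" by metis
  have "P = {x. \<forall>(a, b) \<in> (\<lambda>h. (a h, b h)) ` F. a \<bullet> x \<le> b}"
    using F(2) ab by auto
  then show ?thesis using that F(1) by blast
qed

text \<open>The witness is \<open>P\<close> itself with its coordinates relabelled by natural
  numbers. It guarantees that the \<open>LEAST\<close> in \<open>xc_star\<close> is
  attained.\<close>

lemma zero_one_polytope_nice_01_extension:
  fixes P :: "(real ^ 'p) set"
  assumes P: "zero_one_polytope P"
  shows "\<exists>q Q \<pi>. nice_01_extension q Q \<pi> P"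
proof -
  let ?n = "CARD('p)"
  obtain b :: "nat \<Rightarrow> 'p" where b: "bij_betw b {..<?n} UNIV"
    using ex_bij_betw_nat_finite[of "UNIV :: 'p set"] by (auto simp: atLeast0LessThan)
  define c where "c = the_inv_into {..<?n} b"
  have cb: "c (b i) = i" if "i < ?n" for i
    using that b by (simp add: c_def bij_betw_def the_inv_into_f_f)
  have bc: "b (c k) = k" for k
    using b by (simp add: c_def bij_betw_def f_the_inv_into_f)
  have cn: "c k < ?n" for k
    using b the_inv_into_into[of b "{..<?n}" k] by (auto simp: c_def bij_betw_def)
  define \<phi> :: "real ^ 'p \<Rightarrow> nat \<Rightarrow> real" where "\<phi> x = (\<lambda>i. if i < ?n then x $ b i else 0)" for x
  define \<pi> :: "(nat \<Rightarrow> real) \<Rightarrow> real ^ 'p" where "\<pi> w = (\<chi> k. w (c k))" for w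
  have lin: "linear \<phi>" "linear \<pi>"
    by (auto intro!: linearI simp: \<phi>_def \<pi>_def fun_eq_iff vec_eq_iff scaleR_fun_def)
  have inv: "\<pi> (\<phi> x) = x" for x by (simp add: \<pi>_def \<phi>_def vec_eq_iff cn bc)
  have inv': "\<phi> (\<pi> w) = w" if "w \<in> coord_space ?n" for w
    using that by (auto simp: \<pi>_def \<phi>_def fun_eq_iff coord_space_def cb)
  have inj: "inj \<phi>" using inv by (metis injI)
  have \<phi>c: "\<phi> x \<in> coord_space ?n" for x by (simp add: \<phi>_def coord_space_def)
  have poly: "polytope P" using P by (simp add: zero_one_polytope_def)
  have ver: "vertices (\<phi> ` P) = \<phi> ` vertices P" by (rule vertices_linear_image[OF lin(1) inj])
  have "polyhedron_in ?n (\<phi> ` P)"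
  proof -
    have "polyhedron P" using poly by (rule polytope_imp_polyhedron)
    then obtain H where H: "finite H" "P = {x. \<forall>(a, b) \<in> H. a \<bullet> x \<le> b}"
      by (rule polyhedron_halfspaces)
    \<comment> \<open>Since \<open>\<phi>\<close> preserves inner products, applying it to the
      normals turns a system for \<open>P\<close> into one for its copy.\<close>
    let ?A = "(\<lambda>(a, d). (\<phi> a, d)) ` H"
    have inner: "(\<Sum>i<?n. \<phi> a i * \<phi> x i) = a \<bullet> x" for a x
    proof -
      have "(\<Sum>i<?n. \<phi> a i * \<phi> x i) = (\<Sum>i<?n. a $ b i * x $ b i)" by (simp add: \<phi>_def)
      also have "\<dots> = (\<Sum>k\<in>UNIV. a $ k * x $ k)" by (rule sum.reindex_bij_betw[OF b])
      finally show ?thesis by (simp add: inner_vec_def)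
    qed
    have "\<phi> ` P = {w \<in> coord_space ?n. \<pi> w \<in> P}"
      using inv inv' \<phi>c by force
    also have "\<dots> = {w \<in> coord_space ?n. \<forall>(a, d) \<in> H. (\<Sum>i<?n. \<phi> a i * w i) \<le> d}"
    proof -
      have "a \<bullet> \<pi> w = (\<Sum>i<?n. \<phi> a i * w i)" if "w \<in> coord_space ?n" for a w
        using inner[of a "\<pi> w"] inv'[OF that] by simp
      then show ?thesis unfolding H(2) by auto
    qed
    also have "\<dots> = {w \<in> coord_space ?n. \<forall>(a, d) \<in> ?A. (\<Sum>i<?n. a i * w i) \<le> d}"
      by auto
    finally show ?thesis
      unfolding polyhedron_in_def using H(1) by (intro exI[of _ ?A]) simp
  qed
  moreover have "zero_one_polytope_in ?n (\<phi> ` P)"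
    unfolding zero_one_polytope_in_def ver
    using polytope_linear_image[OF lin(1) poly] \<phi>c P
    by (auto simp: \<phi>_def zero_one_polytope_def)
  moreover have "\<pi> ` \<phi> ` P = P" by (simp add: image_image inv)
  ultimately have "nice_01_extension ?n (\<phi> ` P) \<pi> P"
    unfolding nice_01_extension_def extension_def ver using lin inv by auto
  then show ?thesis by blast
qed

section \<open>The wedge over a nice extension\<close>

lemma nice_01_extension_down:
  fixes P' :: "(real ^ 'p) set" and j :: 'p
  assumes P': "zero_one_polytope P'" and inj: "inj_on (down j) (vertices P')"
    and Q': "nice_01_extension q Q' \<pi>' P'"
  shows "\<exists>Q \<pi>. nice_01_extension (Suc q) Q \<pi> (convex hull (P' \<union> down j ` P')) \<and>
    num_facets Q \<le> num_facets Q' + 2"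
proof -
  define e :: "nat \<Rightarrow> nat \<Rightarrow> real" where "e k = (\<lambda>i. if i = k then 1 else 0)" for k
  \<comment> \<open>All points of \<open>Q'\<close> are supported below \<open>q\<close>, so index
    \<open>q\<close> is free to serve as the height.\<close>
  define t :: "(nat \<Rightarrow> real) \<Rightarrow> real" where "t x = x q" for x
  \<comment> \<open>Clearing coordinate \<open>q\<close> before applying \<open>\<pi>'\<close> makes
    \<open>l\<close> vanish at \<open>e q\<close>, whatever value \<open>\<pi>'\<close> takes
    there.\<close>
  define r where "r x = x - t x *\<^sub>R e q" for x
  define l where "l x = \<pi>' (r x) $ j" for x
  have Q: "polyhedron_in q Q'" "linear \<pi>'" "\<pi>' ` Q' = P'" "polytope Q'" "Q' \<subseteq> coord_space q"
    "\<And>v i. v \<in> vertices Q' \<Longrightarrow> i < q \<Longrightarrow> v i \<in> {0, 1}"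
    "\<And>w. w \<in> vertices Q' \<Longrightarrow> \<pi>' w \<in> vertices P'"
    "\<And>v. v \<in> vertices P' \<Longrightarrow> \<exists>!w. w \<in> vertices Q' \<and> \<pi>' w = v"
    using Q' by (auto simp: nice_01_extension_def extension_def zero_one_polytope_in_def)
  have lin_r: "linear r"
    by (rule linearI) (auto simp: r_def t_def fun_eq_iff scaleR_fun_def algebra_simps)
  have t_base: "t y = 0" if "y \<in> Q'" for y
    using that Q(5) by (auto simp: t_def coord_space_def)
  have r_base: "r y = y" if "y \<in> Q'" for y using t_base[OF that] by (simp add: r_def)
  have P01: "v $ i \<in> {0, 1}" if "v \<in> vertices P'" for v i
    using P' that by (simp add: zero_one_polytope_def)
  have cube: "0 \<le> x $ i \<and> x $ i \<le> 1" if "x \<in> P'" for x i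
    using zero_one_polytope_unit_cube[OF P' that] .
  interpret wedge t l "e q" Q'
  proof (rule wedge.intro)
    show "linear t" by (rule linearI) (auto simp: t_def scaleR_fun_def)
    show "linear l"
      using lin_r Q(2) unfolding l_def
      by (intro linearI) (simp_all add: linear_add linear_scale)
    show "t (e q) = 1" by (simp add: t_def e_def)
    then have "r (e q) = 0" by (simp add: r_def)
    then show "l (e q) = 0" using linear_0[OF Q(2)] by (simp add: l_def)
    show "0 \<le> l y" if "y \<in> Q'" for y
      using cube Q(3) that by (auto simp: l_def r_base)
  qed (use t_base Q(4) in auto)
  \<comment> \<open>The height replaces coordinate \<open>j\<close> of
    \<open>\<pi>' (proj x)\<close>. At height 0 this gives \<open>down j\<close>; at the top, where
    the height is that very coordinate, it gives back \<open>\<pi>'\<close>.\<close>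
  define \<pi> where "\<pi> x = down j (\<pi>' (proj x)) + t x *\<^sub>R axis j 1" for x
  have lin_\<pi>: "linear \<pi>"
    unfolding \<pi>_def
    using linear_add[OF linear_proj] linear_scale[OF linear_proj] linear_add[OF Q(2)]
      linear_scale[OF Q(2)] linear_add[OF linear_down] linear_scale[OF linear_down]
    by (intro linearI) (simp_all add: t_simps algebra_simps)
  have down_split: "down j x + x $ j *\<^sub>R axis j 1 = x" for x
    by (simp add: vec_eq_iff down_def axis_def)
  have \<pi>_base: "\<pi> y = down j (\<pi>' y)" if "y \<in> Q'" for y
    using that by (simp add: \<pi>_def proj_base t_base)
  have \<pi>_lift: "\<pi> (lift y) = \<pi>' y" if "y \<in> Q'" for y
    using that by (simp add: \<pi>_def proj_lift t_lift) (simp add: l_def r_base down_split)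
  let ?P = "convex hull (P' \<union> down j ` P')"
  have vQ: "v \<in> Q'" if "v \<in> vertices Q'" for v
    using that by (simp add: vertices_def extreme_point_of_def)
  \<comment> \<open>Each fibre maps onto a segment between a point of \<open>P'\<close> and its
    image under \<open>down j\<close>. Conversely, the image of \<open>W\<close> is convex and
    contains both generating sets.\<close>
  have image: "\<pi> ` W = ?P"
  proof
    show "\<pi> ` W \<subseteq> ?P"
    proof
      fix z assume "z \<in> \<pi> ` W"
      then obtain x where x: "x \<in> W" "z = \<pi> x" by blast
      then have px: "proj x \<in> Q'" by (simp add: W_def)
      have "z \<in> \<pi> ` closed_segment (proj x) (lift (proj x))" using x mem_fibre by blast
      then have z: "z \<in> closed_segment (down j (\<pi>' (proj x))) (\<pi>' (proj x))"
        using px by (simp add: closed_segment_linear_image[OF lin_\<pi>, symmetric] \<pi>_base \<pi>_lift)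
      have "down j (\<pi>' (proj x)) \<in> ?P" "\<pi>' (proj x) \<in> ?P"
        using px Q(3) by (auto intro!: hull_inc)
      then show "z \<in> ?P" using z closed_segment_subset[OF _ _ convex_convex_hull] by blast
    qed
    have "P' \<subseteq> \<pi> ` W"
    proof
      fix z assume "z \<in> P'"
      then obtain y where "y \<in> Q'" "z = \<pi>' y" using Q(3) by blast
      moreover from this have "lift y \<in> W" using lift_base_eq by blast
      ultimately show "z \<in> \<pi> ` W" using \<pi>_lift by (intro image_eqI[of _ _ "lift y"]) simp_all
    qed
    moreover have "down j ` P' \<subseteq> \<pi> ` W"
    proof
      fix z assume "z \<in> down j ` P'"
      then obtain y where "y \<in> Q'" "z = down j (\<pi>' y)" using Q(3) by blast
      moreover from this have "y \<in> W" using base_subset by blast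
      ultimately show "z \<in> \<pi> ` W" using \<pi>_base by (intro image_eqI[of _ _ y]) simp_all
    qed
    ultimately show "?P \<subseteq> \<pi> ` W"
      by (simp add: hull_minimal convex_linear_image[OF lin_\<pi> convex_W])
  qed
  have coord_lift: "lift v i = (if i = q then l v else v i)" if "v \<in> Q'" for v i
    using t_base[OF that] unfolding lift_def by (auto simp: scaleR_fun_def e_def t_def)
  \<comment> \<open>The height of a lifted vertex is coordinate \<open>j\<close> of a vertex of
    \<open>P'\<close>, so the new coordinate is again 0 or 1.\<close>
  have l01: "l v \<in> {0, 1}" if "v \<in> vertices Q'" for v
    using P01[OF Q(7)[OF that], of j] r_base[OF vQ[OF that]] by (simp add: l_def)
  have base_coord: "y i = 0" if "y \<in> Q'" "i \<ge> q" for y i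
    using that Q(5) by (auto simp: coord_space_def)
  have proj_coord: "proj x i = (if i = q then 0 else x i)" for x i
    unfolding proj_def by (auto simp: t_def e_def scaleR_fun_def)
  have W01: "zero_one_polytope_in (Suc q) W"
    unfolding zero_one_polytope_in_def
  proof (intro conjI ballI allI impI polytope_W)
    show "W \<subseteq> coord_space (Suc q)"
    proof
      fix x assume "x \<in> W"
      then have "proj x \<in> Q'" by (simp add: W_def)
      then have "proj x i = 0" if "i \<ge> q" for i using base_coord that by blast
      then show "x \<in> coord_space (Suc q)"
        unfolding coord_space_def proj_coord by (auto simp: Suc_le_eq) (metis less_imp_le less_irrefl)
    qed
    fix v i assume "v \<in> vertices W" "i < Suc q"
    then consider "v \<in> vertices Q'" | u where "u \<in> vertices Q'" "v = lift u"
      unfolding vertices_W by blast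
    then show "v i \<in> {0, 1}"
    proof cases
      case 1
      then show ?thesis
        using Q(6)[OF 1, of i] base_coord[OF vQ[OF 1], of i] \<open>i < Suc q\<close> by (cases "i < q") auto
    next
      case 2
      then show ?thesis
        using Q(6)[OF 2(1), of i] l01[OF 2(1)] \<open>i < Suc q\<close> by (auto simp: coord_lift vQ less_Suc_eq)
    qed
  qed
  have poly: "polyhedron_in (Suc q) W"
  proof -
    obtain A where A: "finite A" "Q' = {x \<in> coord_space q. \<forall>(a, b) \<in> A. (\<Sum>i<q. a i * x i) \<le> b}"
      using Q(1) by (auto simp: polyhedron_in_def)
    define m where "m i = l (e i)" for i
    \<comment> \<open>The sum stops before \<open>q\<close> because the coefficient there is
      \<open>l (e q) = 0\<close>.\<close>
    have l_sum: "l x = (\<Sum>i<q. m i * x i)" if "x \<in> coord_space (Suc q)" for x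
    proof -
      have "x = (\<Sum>i<Suc q. x i *\<^sub>R e i)"
      proof
        fix k
        have "(\<Sum>i<Suc q. x i *\<^sub>R e i) k = (\<Sum>i<Suc q. x i * e i k)"
          by (induction q) (simp_all add: scaleR_fun_def)
        also have "\<dots> = (\<Sum>i<Suc q. if k = i then x i else 0)"
          by (intro sum.cong) (auto simp: e_def)
        also have "\<dots> = x k" using that by (auto simp: coord_space_def)
        finally show "x k = (\<Sum>i<Suc q. x i *\<^sub>R e i) k" by simp
      qed
      then have "l x = l (\<Sum>i<Suc q. x i *\<^sub>R e i)" by simp
      also have "\<dots> = (\<Sum>i<Suc q. x i * m i)"
        by (simp add: linear_sum[OF linear_l] l_simps m_def)
      finally show ?thesis using l_e by (simp add: m_def mult.commute)
    qed
    \<comment> \<open>The rows express \<open>0 \<le> t x\<close>, \<open>t x \<le> l x\<close> and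
      the old system. Old rows get entry 0 at \<open>q\<close>, so that the longer sum tests
      \<open>proj x\<close>.\<close>
    let ?A = "{(- e q, 0), ((\<lambda>i. if i < q then - m i else e q i), 0)} \<union> (\<lambda>(a, b). (a(q := 0), b)) ` A"
    have "x \<in> W \<longleftrightarrow> x \<in> coord_space (Suc q) \<and> (\<forall>(a, b) \<in> ?A. (\<Sum>i<Suc q. a i * x i) \<le> b)" for x
    proof (cases "x \<in> coord_space (Suc q)")
      case False
      then show ?thesis using W01 by (auto simp: zero_one_polytope_in_def)
    next
      case True
      then have pc: "proj x \<in> coord_space q" by (auto simp: coord_space_def proj_coord)
      have "(\<Sum>i<Suc q. (- e q) i * x i) = - t x" by (simp add: e_def t_def)
      moreover have "(\<Sum>i<Suc q. (if i < q then - m i else e q i) * x i) = t x - l x"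
        by (simp add: l_sum[OF True] e_def t_def sum_negf)
      moreover have "(\<Sum>i<Suc q. (a(q := 0)) i * x i) = (\<Sum>i<q. a i * proj x i)" for a
        by (simp add: proj_coord)
      moreover have "proj x \<in> Q' \<longleftrightarrow> (\<forall>(a, b) \<in> A. (\<Sum>i<q. a i * proj x i) \<le> b)"
        using pc A(2) by blast
      ultimately show ?thesis
        using True by (auto simp: W_def simp del: sum.lessThan_Suc fun_upd_apply)
    qed
    then have "W = {x \<in> coord_space (Suc q). \<forall>(a, b) \<in> ?A. (\<Sum>i<Suc q. a i * x i) \<le> b}"
      by (intro set_eqI) (simp only: mem_Collect_eq)
    then show ?thesis
      unfolding polyhedron_in_def using A(1) by (intro exI[of _ ?A]) simp
  qed
  have cubeP: "0 \<le> x $ i \<and> x $ i \<le> 1" if "x \<in> ?P" for x i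
  proof -
    have "P' \<union> down j ` P' \<subseteq> {x. \<forall>i. 0 \<le> x $ i \<and> x $ i \<le> 1}"
      using cube by (auto simp: down_def)
    then have "?P \<subseteq> {x. \<forall>i. 0 \<le> x $ i \<and> x $ i \<le> 1}"
      by (rule hull_minimal) (rule convex_unit_cube)
    then show ?thesis using that by blast
  qed
  have vP: "v \<in> P'" if "v \<in> vertices P'" for v
    using that by (simp add: vertices_def extreme_point_of_def)
  \<comment> \<open>Both points have 0/1 coordinates and lie in a set inside the unit cube, which
    makes them extreme.\<close>
  have vert1: "v \<in> vertices ?P" "down j v \<in> vertices ?P" if "v \<in> vertices P'" for v
  proof -
    have in_P: "v \<in> ?P" "down j v \<in> ?P" using vP[OF that] by (auto intro: hull_inc)
    show "v \<in> vertices ?P" by (rule zero_one_vertex[OF in_P(1) P01[OF that] cubeP])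
    have "down j v $ i \<in> {0, 1}" for i using P01[OF that, of i] by (simp add: down_def)
    then show "down j v \<in> vertices ?P" by (rule zero_one_vertex[OF in_P(2) _ cubeP])
  qed
  have verts: "\<pi> w \<in> vertices ?P" if "w \<in> vertices W" for w
    using that vert1 Q(7) unfolding vertices_W by (auto simp: \<pi>_base \<pi>_lift vQ)
  \<comment> \<open>The hull is generated by the vertices of \<open>P'\<close> and their images
    under \<open>down j\<close>, so its extreme points are among these.\<close>
  have vert2: "\<exists>u \<in> vertices P'. v = u \<or> v = down j u" if "v \<in> vertices ?P" for v
  proof -
    have PV: "P' = convex hull vertices P'"
      using P' by (intro polytope_hull_vertices) (simp add: zero_one_polytope_def)
    have dP: "down j ` P' = convex hull (down j ` vertices P')"
      by (subst PV) (rule convex_hull_linear_image[OF linear_down])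
    have "convex (\<Inter>T)" if "Ball T convex" for T :: "(real ^ 'p) set set"
      using that by (intro convex_Inter) blast
    then have "convex hull (vertices P' \<union> down j ` vertices P') = ?P"
      using hull_Un[of convex "vertices P'" "down j ` vertices P'"]
      by (simp only: PV[symmetric] dP[symmetric])
    then have "v extreme_point_of convex hull (vertices P' \<union> down j ` vertices P')"
      using that by (simp only: vertices_def mem_Collect_eq)
    then have "v \<in> vertices P' \<union> down j ` vertices P'" by (rule extreme_point_of_convex_hull)
    then show ?thesis by blast
  qed
  \<comment> \<open>Coordinate \<open>j\<close> of \<open>\<pi> w\<close> is the height, and the
    other coordinates give \<open>down j (\<pi>' (proj w))\<close>. Injectivity of
    \<open>down j\<close> on vertices recovers \<open>\<pi>' (proj w)\<close>, and niceness of
    \<open>Q'\<close> then recovers \<open>proj w\<close>.\<close>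
  have uniq: "w = w'" if w: "w \<in> vertices W" "w' \<in> vertices W" "\<pi> w = \<pi> w'" for w w'
  proof -
    have dd: "down j (down j x) = down j x" for x by (simp add: down_def vec_eq_iff)
    have *: "proj w \<in> vertices Q'" "down j (\<pi> w) = down j (\<pi>' (proj w))"
      "t w = \<pi> w $ j" if "w \<in> vertices W" for w
    proof -
      show "proj w \<in> vertices Q'"
        using that unfolding vertices_W by (auto simp: vQ proj_base proj_lift)
      have "down j (axis j 1) = 0" by (simp add: down_def vec_eq_iff axis_def)
      then show "down j (\<pi> w) = down j (\<pi>' (proj w))"
        by (simp add: \<pi>_def linear_add[OF linear_down] linear_scale[OF linear_down] dd)
      show "t w = \<pi> w $ j" by (simp add: \<pi>_def down_def)
    qed
    have "down j (\<pi>' (proj w)) = down j (\<pi>' (proj w'))" using * w by metis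
    then have "\<pi>' (proj w) = \<pi>' (proj w')"
      using inj_onD[OF inj] Q(7) *(1) w by blast
    then have "proj w = proj w'" using Q(8) Q(7) *(1) w by metis
    moreover have "t w = t w'" using * w by metis
    ultimately show ?thesis unfolding proj_def by simp
  qed
  have "\<exists>w. w \<in> vertices W \<and> \<pi> w = v" if v: "v \<in> vertices ?P" for v
  proof -
    obtain u where u: "u \<in> vertices P'" "v = u \<or> v = down j u" using vert2[OF v] by blast
    obtain w where w: "w \<in> vertices Q'" "\<pi>' w = u" using Q(8)[OF u(1)] by blast
    have "w \<in> vertices W" "lift w \<in> vertices W" using w(1) vertices_W by blast+
    then show ?thesis using u(2) w \<pi>_base[OF vQ[OF w(1)]] \<pi>_lift[OF vQ[OF w(1)]] by metis
  qed
  then have "nice_01_extension (Suc q) W \<pi> ?P"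
    unfolding nice_01_extension_def extension_def
    using poly lin_\<pi> image W01 verts uniq by blast
  then show ?thesis using num_facets_W by blast
qed

theorem theorem2p11:
  fixes P' :: "(real ^ 'p) set" and j :: 'p
  assumes "zero_one_polytope P'"
    and "inj_on (down j) (vertices P')"
  shows "xc_star (convex hull (P' \<union> down j ` P')) \<le> xc_star P' + 2"
proof -
  let ?ext = "\<lambda>P k. \<exists>q Q \<pi>. nice_01_extension q Q \<pi> P \<and> num_facets Q = k"
  have "\<exists>k. ?ext P' k" using zero_one_polytope_nice_01_extension[OF assms(1)] by blast
  then have "?ext P' (xc_star P')" unfolding xc_star_def by (rule LeastI_ex)
  then obtain q Q' \<pi>' where Q': "nice_01_extension q Q' \<pi>' P'" "num_facets Q' = xc_star P'"
    by blast
  obtain Q \<pi> where Q: "nice_01_extension (Suc q) Q \<pi> (convex hull (P' \<union> down j ` P'))"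
      "num_facets Q \<le> num_facets Q' + 2"
    using nice_01_extension_down[OF assms Q'(1)] by blast
  \<comment> \<open>For the upper bound a single nice extension suffices, while
    \<open>xc_star P'\<close> had to be attained to supply \<open>Q'\<close>.\<close>
  have "xc_star (convex hull (P' \<union> down j ` P')) \<le> num_facets Q"
    unfolding xc_star_def using Q(1) by (intro Least_le) blast
  then show ?thesis using Q(2) Q'(2) by simp
qed

end
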